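(* Let $\alpha\in\mathbb{N}^{m\times n}$ be a matrix of nonnegative integers. Suppose $X\subset\mathbb{R}^n$ is representable as $X=\mathrm{cl}\{x\in\mathbb{R}^n : \mathbf{0}<|x|,\ H(|x|)\le\mathbf{1}\}$ for a continuous map $H:\mathbb{R}^n\to\mathbb{R}^r$. Then for $Y=\{y\in\mathbb{R}^n : H(\exp y)\le\mathbf{1}\}$, we have $$\mathsf{C}_{\mathsf{SAGE}}^{\mathsf{POLY}}(\alpha,X)=\{c\in\mathbb{R}^m : \mathrm{SR}(\alpha,c)\cap\mathsf{C}_{\mathsf{SAGE}}(\alpha,Y)\text{ is nonempty}\}.$$
   Context: Vector inequalities (strict and non-strict) are elementwise, $\exp$ and $|\cdot|$ act elementwise on vectors, $\mathbf{1}$ is the all-ones vector, and $\mathrm{cl}$ is closure in the standard topology of $\mathbb{R}^n$. $\mathbb{N}$ contains $0$. Write $\alpha_1,\dots,\alpha_m$ for the rows of $\alpha$. For a vector $c\in\mathbb{R}^m$, $c_{\setminus k}$ is $c$ with its $k$-th entry deleted. Sums of sets are Minkowski sums. Signomials: $\mathrm{Sig}(\alpha,c)$ is the function $y\mapsto\sum_{j=1}^m c_j\exp(\alpha_j\cdot y)$ on $\mathbb{R}^n$. For any $Y\subset\mathbb{R}^n$ and $k \in \{1,\dots,m\}$, $$\mathsf{C}_{\mathsf{AGE}}(\alpha,k,Y)=\{c\in\mathbb{R}^m : c_{\setminus k}\ge\mathbf{0},\ \mathrm{Sig}(\alpha,c)(y)\ge0 \text{ for all } y\in Y\},\qquad \mathsf{C}_{\mathsf{SAGE}}(\alpha,Y)=\sum_{k=1}^m\mathsf{C}_{\mathsf{AGE}}(\alpha,k,Y).$$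 Polynomials: $x^{\alpha_j}=\prod_{l=1}^n x_l^{\alpha_{jl}}$ (with $0^0=1$), and $\mathrm{Poly}(\alpha,c)$ is the polynomial $x\mapsto\sum_{j=1}^m c_j x^{\alpha_j}$. For any $X\subset\mathbb{R}^n$ and $i \in \{1,\dots,m\}$, $\mathsf{C}_{\mathsf{AGE}}^{\mathsf{POLY}}(\alpha,i,X)$ is the set of $c\in\mathbb{R}^m$ such that: (1) $\mathrm{Poly}(\alpha,c)(x)\ge0$ for all $x\in X$; (2) $c_j\ge0$ whenever $j\ne i$ and $x^{\alpha_j}>0$ for some $x\in X$; (3) $c_j\le0$ whenever $j\ne i$ and $x^{\alpha_j}<0$ for some $x\in X$. Then $$\mathsf{C}_{\mathsf{SAGE}}^{\mathsf{POLY}}(\alpha,X)=\sum_{k=1}^m\mathsf{C}_{\mathsf{AGE}}^{\mathsf{POLY}}(\alpha,k,X).$$ Signomial representative coefficient vectors: for $c\in\mathbb{R}^m$, $$\mathrm{SR}(\alpha,c)=\{\hat c\in\mathbb{R}^m : \hat c_i=c_i \text{ whenever } \alpha_i\in 2\mathbb{N}^{1\times n},\ \text{and } \hat c_i\le-|c_i| \text{ whenever } \alpha_i\notin 2\mathbb{N}^{1\times n}\},$$ where $2\mathbb{N}^{1\times n}$ is the set of row vectors whose entries are all even nonnegative integers. *)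

theory Defs
  imports "HOL-Analysis.Analysis" "HOL-Library.Set_Algebras"
begin

(* Conventions: the order, the absolute value and the constant 1 on real ^ 'n are the
   componentwise ones of the library.  The library's strict order on real ^ 'n, however, is
   the strict part of the componentwise order, so elementwise strict inequality is always
   written out with an explicit quantifier over the coordinates. *)

definition vexp :: "real ^ 'n \<Rightarrow> real ^ 'n"
  where "vexp y = (\<chi> i. exp (y $ i))"

definition real_mat :: "nat ^ 'n ^ 'm \<Rightarrow> real ^ 'n ^ 'm"
  where "real_mat \<alpha> = (\<chi> j l. real (\<alpha> $ j $ l))"

definition Sig :: "real ^ 'n ^ 'm \<Rightarrow> real ^ 'm \<Rightarrow> real ^ 'n \<Rightarrow> real"
  where "Sig \<alpha> c y = (\<Sum>j\<in>UNIV. c $ j * exp ((\<alpha> $ j) \<bullet> y))"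

definition C_AGE :: "real ^ 'n ^ 'm \<Rightarrow> 'm \<Rightarrow> (real ^ 'n) set \<Rightarrow> (real ^ 'm) set"
  where "C_AGE \<alpha> k Y = {c. (\<forall>j. j \<noteq> k \<longrightarrow> 0 \<le> c $ j) \<and> (\<forall>y\<in>Y. 0 \<le> Sig \<alpha> c y)}"

(* The sum of sets here and in C_SAGE_POLY is the Minkowski sum of HOL-Library.Set_Algebras. *)
definition C_SAGE :: "real ^ 'n ^ 'm \<Rightarrow> (real ^ 'n) set \<Rightarrow> (real ^ 'm) set"
  where "C_SAGE \<alpha> Y = (\<Sum>k\<in>UNIV. C_AGE \<alpha> k Y)"

definition monomial :: "real ^ 'n \<Rightarrow> nat ^ 'n \<Rightarrow> real"
  where "monomial x a = (\<Prod>l\<in>UNIV. (x $ l) ^ (a $ l))"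

definition Poly :: "nat ^ 'n ^ 'm \<Rightarrow> real ^ 'm \<Rightarrow> real ^ 'n \<Rightarrow> real"
  where "Poly \<alpha> c x = (\<Sum>j\<in>UNIV. c $ j * monomial x (\<alpha> $ j))"

definition C_AGE_POLY :: "nat ^ 'n ^ 'm \<Rightarrow> 'm \<Rightarrow> (real ^ 'n) set \<Rightarrow> (real ^ 'm) set"
  where "C_AGE_POLY \<alpha> i X =
    {c. (\<forall>x\<in>X. 0 \<le> Poly \<alpha> c x) \<and>
        (\<forall>j. j \<noteq> i \<and> (\<exists>x\<in>X. monomial x (\<alpha> $ j) > 0) \<longrightarrow> c $ j \<ge> 0) \<and>
        (\<forall>j. j \<noteq> i \<and> (\<exists>x\<in>X. monomial x (\<alpha> $ j) < 0) \<longrightarrow> c $ j \<le> 0)}"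

definition C_SAGE_POLY :: "nat ^ 'n ^ 'm \<Rightarrow> (real ^ 'n) set \<Rightarrow> (real ^ 'm) set"
  where "C_SAGE_POLY \<alpha> X = (\<Sum>k\<in>UNIV. C_AGE_POLY \<alpha> k X)"

definition even_vecs :: "(nat ^ 'n) set"
  where "even_vecs = {a. \<forall>l. even (a $ l)}"

definition SR :: "nat ^ 'n ^ 'm \<Rightarrow> real ^ 'm \<Rightarrow> (real ^ 'm) set"
  where "SR \<alpha> c =
    {d. (\<forall>i. \<alpha> $ i \<in> even_vecs \<longrightarrow> d $ i = c $ i) \<and>
        (\<forall>i. \<alpha> $ i \<notin> even_vecs \<longrightarrow> d $ i \<le> - \<bar>c $ i\<bar>)}"

end

theory Submission
  imports Defs
begin

text \<open>
  On the nonempty sign-symmetric set whose closure is X, a monomial with an odd exponent takes both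
  signs, so the polynomial AGE cones force all odd coefficients but the distinguished one to vanish,
  and nonnegativity on X becomes nonnegativity on Y after replacing that coefficient by the negative
  of its modulus.  Conversely, a SAGE decomposition of a vector can be rearranged so that any
  nonpositive coefficient comes from its own summand only: add to the other summands suitable
  multiples of that one, which cancel their contributions.
\<close>

section \<open>Minkowski sums and linearity of signomials\<close>

lemma mem_C_SAGE_iff:
  "c \<in> C_SAGE \<alpha> Y \<longleftrightarrow> (\<exists>f. c = (\<Sum>k\<in>UNIV. f k) \<and> (\<forall>k. f k \<in> C_AGE \<alpha> k Y))"
  unfolding C_SAGE_def by (subst set_sum_alt) auto

lemma mem_C_SAGE_POLY_iff:
  "c \<in> C_SAGE_POLY \<alpha> X \<longleftrightarrow> (\<exists>f. c = (\<Sum>k\<in>UNIV. f k) \<and> (\<forall>k. f k \<in> C_AGE_POLY \<alpha> k X))"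
  unfolding C_SAGE_POLY_def by (subst set_sum_alt) auto

lemma Sig_add: "Sig \<alpha> (c + d) y = Sig \<alpha> c y + Sig \<alpha> d y"
  by (simp add: Sig_def distrib_right sum.distrib)

lemma Sig_scaleR: "Sig \<alpha> (r *\<^sub>R c) y = r * Sig \<alpha> c y"
  by (simp add: Sig_def sum_distrib_left mult.assoc)

lemma C_AGE_scaleR: "c \<in> C_AGE \<alpha> k Y \<Longrightarrow> 0 \<le> r \<Longrightarrow> r *\<^sub>R c \<in> C_AGE \<alpha> k Y"
  by (auto simp: C_AGE_def Sig_scaleR)

section \<open>Exponential substitution and sign changes of monomials\<close>

lemma monomial_vexp: "monomial (vexp y) (\<alpha> $ j) = exp (real_mat \<alpha> $ j \<bullet> y)"
  by (simp add: monomial_def vexp_def real_mat_def inner_vec_def exp_sum exp_of_nat_mult)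

lemma Poly_vexp: "Poly \<alpha> c (vexp y) = Sig (real_mat \<alpha>) c y"
  by (simp add: Poly_def Sig_def monomial_vexp)

lemma abs_vexp [simp]: "\<bar>vexp y\<bar> = vexp y"
  by (simp add: vec_eq_iff vexp_def abs_vec_def)

lemma vexp_ln:
  assumes "\<forall>i. 0 < x $ i"
  shows "vexp (\<chi> i. ln (x $ i)) = x"
  using assms by (simp add: vec_eq_iff vexp_def)

lemma abs_monomial: "\<bar>monomial x a\<bar> = monomial \<bar>x\<bar> a"
  by (simp add: monomial_def abs_prod power_abs abs_vec_def)

lemma monomial_even_nonneg: "a \<in> even_vecs \<Longrightarrow> 0 \<le> monomial x a"
  unfolding monomial_def by (rule prod_nonneg) (auto simp: even_vecs_def zero_le_even_power)

lemma monomial_even_abs: "a \<in> even_vecs \<Longrightarrow> monomial \<bar>x\<bar> a = monomial x a"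
  using abs_monomial[of x a] monomial_even_nonneg[of a x] by simp

text \<open>Negating a single coordinate whose exponent is odd suffices.\<close>

lemma monomial_odd_flip:
  fixes x :: "real ^ 'n"
  assumes "a \<notin> even_vecs"
  obtains x' where "\<bar>x'\<bar> = \<bar>x\<bar>" "monomial x' a = - monomial x a"
proof -
  from assms obtain l where l: "odd (a $ l)"
    by (auto simp: even_vecs_def)
  define x' :: "real ^ 'n" where "x' = (\<chi> i. if i = l then - x $ i else x $ i)"
  have "\<bar>x'\<bar> = \<bar>x\<bar>"
    by (simp add: x'_def vec_eq_iff abs_vec_def)
  moreover have "monomial x' a = - monomial x a"
    using l by (simp add: monomial_def prod.remove[of UNIV l] x'_def)
  ultimately show ?thesis
    by (rule that)
qed

lemma continuous_on_Poly: "continuous_on S (Poly \<alpha> c)"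
  unfolding Poly_def[abs_def] monomial_def by (intro continuous_intros)

lemma Poly_nonneg_closure:
  assumes "\<And>x. x \<in> S \<Longrightarrow> 0 \<le> Poly \<alpha> c x" and "x \<in> closure S"
  shows "0 \<le> Poly \<alpha> c x"
proof -
  have "closed {x. 0 \<le> Poly \<alpha> c x}"
    by (intro closed_Collect_le continuous_on_const continuous_on_Poly)
  with assms show ?thesis
    using closure_minimal[of S "{x. 0 \<le> Poly \<alpha> c x}"] by blast
qed

section \<open>Rearranging signomial SAGE decompositions\<close>

lemma sum_component_eq_diagonal:
  fixes f :: "'m :: finite \<Rightarrow> real ^ 'm"
  assumes "\<And>k. k \<noteq> i \<Longrightarrow> f k $ i = 0"
  shows "(\<Sum>k\<in>UNIV. f k) $ i = f i $ i"
  using assms by (simp add: sum.remove[of UNIV i])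

text \<open>Only \<open>f i\<close> may have a negative entry at \<open>i\<close>, and it must
  outweigh the nonnegative entries there of all other summands. The last conclusion says that zeros
  already produced at other coordinates survive, so coordinates can be treated one after
  another.\<close>

lemma AGE_decomposition_eliminate_one:
  fixes f :: "'m :: finite \<Rightarrow> real ^ 'm"
  assumes f: "\<And>k. f k \<in> C_AGE \<alpha> k Y" and nonpos: "(\<Sum>k\<in>UNIV. f k) $ i \<le> 0"
  obtains g where "\<And>k. g k \<in> C_AGE \<alpha> k Y" "(\<Sum>k\<in>UNIV. g k) = (\<Sum>k\<in>UNIV. f k)"
    "\<And>k. k \<noteq> i \<Longrightarrow> g k $ i = 0"
    "\<And>j k. j \<noteq> i \<Longrightarrow> k \<noteq> j \<Longrightarrow> (\<And>k'. k' \<noteq> j \<Longrightarrow> f k' $ j = 0) \<Longrightarrow> g k $ j = 0"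
proof -
  define s where "s = (\<Sum>k\<in>UNIV - {i}. f k $ i)"
  have ge: "0 \<le> f k $ j" if "j \<noteq> k" for k j
    using f[of k] that by (auto simp: C_AGE_def)
  have fi: "f i $ i + s \<le> 0"
    using nonpos by (simp add: s_def sum.remove[of UNIV i])
  have s0: "0 \<le> s"
    unfolding s_def by (intro sum_nonneg ge) auto
  show ?thesis
  \<comment> \<open>If this entry is zero, the other entries at \<open>i\<close> vanish too and
    \<open>f\<close> itself works; otherwise it is negative and one may divide by it.\<close>
  proof (cases "f i $ i = 0")
    case True
    with fi s0 have "s = 0"
      by simp
    then have "f k $ i = 0" if "k \<noteq> i" for k
      using that ge unfolding s_def by (subst (asm) sum_nonneg_eq_0_iff) auto
    then show ?thesis
      using f by (intro that[of f]) auto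
  next
    case False
    define d where "d = - f i $ i"
    have d: "0 < d" "s \<le> d" "f i $ i = - d"
      using fi s0 False by (auto simp: d_def)
    \<comment> \<open>The multiple of \<open>f i\<close> given to summand \<open>k\<close> cancels
      its entry at \<open>i\<close>, because \<open>f i $ i = - d\<close>. In total
      \<open>s / d\<close> copies are given away, at most one, so a nonnegative multiple of
      \<open>f i\<close> is left.\<close>
    define g where "g k = (if k = i then (1 - s / d) *\<^sub>R f i else f k + (f k $ i / d) *\<^sub>R f i)" for k
    have "g k \<in> C_AGE \<alpha> k Y" for k
    proof (cases "k = i")
      case True
      with f d show ?thesis
        by (auto simp: g_def intro!: C_AGE_scaleR)
    next
      case False
      define r where "r = f k $ i / d"
      have r: "0 \<le> r"
        using ge[of i k] False d by (simp add: r_def)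
      have "0 \<le> g k $ j" if "j \<noteq> k" for j
      proof (cases "j = i")
        case True
        then show ?thesis
          using False d by (simp add: g_def)
      next
        case ji: False
        then show ?thesis
          using ge[of j k] ge[of j i] that False r by (simp add: g_def r_def[symmetric])
      qed
      moreover have "0 \<le> Sig \<alpha> (g k) y" if "y \<in> Y" for y
        using f[of k] f[of i] that False r
        by (auto simp: g_def r_def[symmetric] Sig_add Sig_scaleR C_AGE_def)
      ultimately show ?thesis
        by (auto simp: C_AGE_def)
    qed
    moreover have "(\<Sum>k\<in>UNIV. g k) = (\<Sum>k\<in>UNIV. f k)"
    proof -
      have "(\<Sum>k\<in>UNIV. g k) = g i + (\<Sum>k\<in>UNIV - {i}. f k + (f k $ i / d) *\<^sub>R f i)"
        by (subst sum.remove[of UNIV i]) (auto simp: g_def intro!: sum.cong)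
      also have "\<dots> = g i + (s / d) *\<^sub>R f i + (\<Sum>k\<in>UNIV - {i}. f k)"
        by (simp add: sum.distrib scaleR_left.sum[symmetric] s_def sum_divide_distrib)
      also have "\<dots> = (\<Sum>k\<in>UNIV. f k)"
        by (simp add: g_def algebra_simps sum.remove[of UNIV i])
      finally show ?thesis .
    qed
    moreover have "g k $ i = 0" if "k \<noteq> i" for k
      using that d by (simp add: g_def)
    \<comment> \<open>Both ingredients of \<open>g k\<close> vanish at \<open>j\<close>:
      \<open>f k\<close> since \<open>k\<close> differs from \<open>j\<close>, and
      \<open>f i\<close> since \<open>i\<close> does.\<close>
    moreover have "g k $ j = 0" if "j \<noteq> i" "k \<noteq> j" "\<And>k'. k' \<noteq> j \<Longrightarrow> f k' $ j = 0" for j k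
      using that(1,2) that(3)[of k] that(3)[of i] by (simp add: g_def)
    ultimately show ?thesis
      by (rule that)
  qed
qed

lemma C_SAGE_decomposition_nonpos:
  fixes I :: "'m :: finite set"
  assumes "c \<in> C_SAGE \<alpha> Y" and "\<And>i. i \<in> I \<Longrightarrow> c $ i \<le> 0"
  shows "\<exists>f. c = (\<Sum>k\<in>UNIV. f k) \<and> (\<forall>k. f k \<in> C_AGE \<alpha> k Y) \<and>
    (\<forall>i\<in>I. \<forall>k. k \<noteq> i \<longrightarrow> f k $ i = 0)"
proof -
  have "finite I"
    by simp
  then show ?thesis
    using assms(2)
  proof (induction I rule: finite_induct)
    case empty
    then show ?case
      using assms(1) by (simp add: mem_C_SAGE_iff)
  next
    case (insert i I)
    then obtain f where f: "c = (\<Sum>k\<in>UNIV. f k)" "\<And>k. f k \<in> C_AGE \<alpha> k Y"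
      "\<And>j k. j \<in> I \<Longrightarrow> k \<noteq> j \<Longrightarrow> f k $ j = 0"
      by auto
    have "(\<Sum>k\<in>UNIV. f k) $ i \<le> 0"
      using insert.prems[of i] f(1) by simp
    then obtain g where g: "\<And>k. g k \<in> C_AGE \<alpha> k Y" "(\<Sum>k\<in>UNIV. g k) = (\<Sum>k\<in>UNIV. f k)"
      "\<And>k. k \<noteq> i \<Longrightarrow> g k $ i = 0"
      "\<And>j k. j \<noteq> i \<Longrightarrow> k \<noteq> j \<Longrightarrow> (\<And>k'. k' \<noteq> j \<Longrightarrow> f k' $ j = 0) \<Longrightarrow> g k $ j = 0"
      using AGE_decomposition_eliminate_one[OF f(2)] by blast
    have "g k $ j = 0" if "j \<in> insert i I" "k \<noteq> j" for j k
      using that g(3) g(4)[of j k] f(3) by (cases "j = i") auto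
    then show ?case
      using g(1,2) f(1) by (intro exI[of _ g]) simp
  qed
qed

section \<open>The case of empty \<open>Y\<close>, and a canonical element of
  \<open>SR\<close>\<close>

lemma C_SAGE_empty: "C_SAGE \<alpha> {} = UNIV"
proof -
  have "c \<in> C_SAGE \<alpha> {}" for c
  proof -
    \<comment> \<open>With no points to test, only the off-diagonal signs are constrained, so every
      coordinate may sit in its own summand.\<close>
    have "c = (\<Sum>k\<in>UNIV. axis k (c $ k))"
      by (simp add: vec_eq_iff axis_def)
    then show ?thesis
      unfolding mem_C_SAGE_iff
      by (intro exI[of _ "\<lambda>k. axis k (c $ k)"]) (auto simp: C_AGE_def axis_def)
  qed
  then show ?thesis
    by blast
qed

lemma SR_nonempty: "SR \<alpha> c \<noteq> {}"
proof -
  have "(\<chi> i. if \<alpha> $ i \<in> even_vecs then c $ i else - \<bar>c $ i\<bar>) \<in> SR \<alpha> c"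
    by (simp add: SR_def)
  then show ?thesis
    by blast
qed

section \<open>Passing between polynomial and signomial AGE cones\<close>

lemma C_AGE_POLY_offdiagonal:
  assumes c: "c \<in> C_AGE_POLY \<alpha> k X" and X: "\<And>x. \<bar>x\<bar> = vexp y \<Longrightarrow> x \<in> X" and "j \<noteq> k"
  shows "0 \<le> c $ j" and "\<alpha> $ j \<notin> even_vecs \<Longrightarrow> c $ j = 0"
proof -
  have pos: "0 < monomial (vexp y) (\<alpha> $ j)"
    by (simp add: monomial_vexp)
  have "vexp y \<in> X"
    by (simp add: X)
  with c pos \<open>j \<noteq> k\<close> show ge: "0 \<le> c $ j"
    unfolding C_AGE_POLY_def by blast
  assume odd: "\<alpha> $ j \<notin> even_vecs"
  \<comment> \<open>An odd monomial is positive at \<open>vexp y\<close> and negative at this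
    reflected point, so both sign conditions apply to \<open>c $ j\<close>.\<close>
  obtain x where x: "\<bar>x\<bar> = \<bar>vexp y\<bar>" "monomial x (\<alpha> $ j) = - monomial (vexp y) (\<alpha> $ j)"
    using monomial_odd_flip[OF odd] .
  from x have "x \<in> X" "monomial x (\<alpha> $ j) < 0"
    using pos X by auto
  with c \<open>j \<noteq> k\<close> have "c $ j \<le> 0"
    unfolding C_AGE_POLY_def by blast
  with ge show "c $ j = 0"
    by simp
qed

lemma C_AGE_POLY_imp_C_AGE:
  fixes \<alpha> :: "nat ^ 'n ^ 'm"
  assumes c: "c \<in> C_AGE_POLY \<alpha> k X" and X: "\<And>x y. y \<in> Y \<Longrightarrow> \<bar>x\<bar> = vexp y \<Longrightarrow> x \<in> X"
    and Y: "Y \<noteq> {}"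
  shows "(\<chi> j. if \<alpha> $ j \<in> even_vecs then c $ j else - \<bar>c $ j\<bar>) \<in> C_AGE (real_mat \<alpha>) k Y"
    (is "?d \<in> _")
proof -
  have off: "0 \<le> c $ j" "\<alpha> $ j \<notin> even_vecs \<Longrightarrow> c $ j = 0" if "j \<noteq> k" for j
    using C_AGE_POLY_offdiagonal[OF c] X Y that by blast+
  have "0 \<le> Sig (real_mat \<alpha>) ?d y" if y: "y \<in> Y" for y
  proof -
    have nonneg: "0 \<le> Poly \<alpha> c x" if "\<bar>x\<bar> = vexp y" for x
      using c X[OF y that] by (simp add: C_AGE_POLY_def)
    \<comment> \<open>Choose the signs of \<open>x\<close> so that the distinguished term, if odd,
      takes its smallest possible value. The other odd terms are zero and the even ones ignore
      signs, so \<open>Poly\<close> at \<open>x\<close> is exactly the signomial of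
      \<open>?d\<close> at \<open>y\<close>.\<close>
    obtain x where x: "\<bar>x\<bar> = vexp y"
      "\<alpha> $ k \<notin> even_vecs \<Longrightarrow> 0 < c $ k \<Longrightarrow> monomial x (\<alpha> $ k) = - monomial (vexp y) (\<alpha> $ k)"
      "\<alpha> $ k \<notin> even_vecs \<Longrightarrow> c $ k \<le> 0 \<Longrightarrow> monomial x (\<alpha> $ k) = monomial (vexp y) (\<alpha> $ k)"
      using monomial_odd_flip[of "\<alpha> $ k" "vexp y"] abs_vexp[of y] by (metis not_le)
    have "Poly \<alpha> c x = Poly \<alpha> ?d (vexp y)"
      unfolding Poly_def
    proof (rule sum.cong)
      fix j
      show "c $ j * monomial x (\<alpha> $ j) = ?d $ j * monomial (vexp y) (\<alpha> $ j)"
      proof (cases "\<alpha> $ j \<in> even_vecs")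
        case True
        then show ?thesis
          using monomial_even_abs[OF True, of x] x(1) by simp
      next
        case False
        then show ?thesis
        proof (cases "j = k")
          case True
          with False show ?thesis
            using x(2,3) by (cases "0 < c $ k") simp_all
        qed (use off(2) in simp)
      qed
    qed simp
    with nonneg[OF x(1)] show ?thesis
      by (simp add: Poly_vexp)
  qed
  then show ?thesis
    using off by (auto simp: C_AGE_def)
qed

text \<open>Term by term, the signomial of \<open>d\<close> at \<open>y\<close> is a lower bound for
  the polynomial of \<open>c\<close> at every point with modulus \<open>vexp y\<close>;
  nonnegativity then extends to the closure by continuity.\<close>

lemma C_AGE_imp_C_AGE_POLY:
  fixes \<alpha> :: "nat ^ 'n ^ 'm"
  assumes d: "d \<in> C_AGE (real_mat \<alpha>) k Y"
    and odd: "\<And>j. j \<noteq> k \<Longrightarrow> \<alpha> $ j \<notin> even_vecs \<Longrightarrow> d $ j = 0"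
    and off: "\<And>j. j \<noteq> k \<Longrightarrow> c $ j = d $ j"
    and diag: "if \<alpha> $ k \<in> even_vecs then c $ k = d $ k else d $ k \<le> - \<bar>c $ k\<bar>"
    and S: "\<And>x. x \<in> S \<Longrightarrow> \<exists>y\<in>Y. \<bar>x\<bar> = vexp y"
  shows "c \<in> C_AGE_POLY \<alpha> k (closure S)"
proof -
  have "0 \<le> Poly \<alpha> c x" if "x \<in> S" for x
  proof -
    from S[OF that] obtain y where y: "y \<in> Y" "\<bar>x\<bar> = vexp y"
      by blast
    have "Poly \<alpha> d (vexp y) \<le> Poly \<alpha> c x"
      unfolding Poly_def
    proof (rule sum_mono)
      fix j
      show "d $ j * monomial (vexp y) (\<alpha> $ j) \<le> c $ j * monomial x (\<alpha> $ j)"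
      proof (cases "\<alpha> $ j \<in> even_vecs")
        case True
        then show ?thesis
          using off[of j] diag monomial_even_abs[OF True, of x] y(2) by (cases "j = k") auto
      next
        case False
        show ?thesis
        proof (cases "j = k")
          case True
          have "d $ j * monomial (vexp y) (\<alpha> $ j) \<le> - \<bar>c $ j\<bar> * monomial (vexp y) (\<alpha> $ j)"
            using diag False True by (intro mult_right_mono) (auto simp: monomial_vexp)
          also have "\<dots> = - \<bar>c $ j * monomial x (\<alpha> $ j)\<bar>"
            by (simp add: abs_mult abs_monomial y(2))
          also have "\<dots> \<le> c $ j * monomial x (\<alpha> $ j)"
            by linarith
          finally show ?thesis .
        qed (use False odd off in auto)
      qed
    qed
    moreover have "0 \<le> Poly \<alpha> d (vexp y)"
      using d y(1) by (simp add: Poly_vexp C_AGE_def)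
    ultimately show ?thesis
      by simp
  qed
  then have "0 \<le> Poly \<alpha> c x" if "x \<in> closure S" for x
    using Poly_nonneg_closure that by blast
  moreover have "0 \<le> c $ j" if "j \<noteq> k" for j
    using d off that by (auto simp: C_AGE_def)
  \<comment> \<open>A monomial taking a negative value is odd, and there \<open>c $ j\<close> is
    zero.\<close>
  moreover have "c $ j \<le> 0" if "j \<noteq> k" "monomial x (\<alpha> $ j) < 0" for j x
    using odd off that monomial_even_nonneg[of "\<alpha> $ j" x] by force
  ultimately show ?thesis
    by (auto simp: C_AGE_POLY_def)
qed

section \<open>The two inclusions between the cones\<close>

theorem theorem10:
  fixes \<alpha> :: "nat ^ 'n ^ 'm"
    and H :: "real ^ 'n \<Rightarrow> real ^ 'r"
    and X Y :: "(real ^ 'n) set"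
  assumes "continuous_on UNIV H"
    and "X = closure {x. (\<forall>i. 0 < \<bar>x\<bar> $ i) \<and> H \<bar>x\<bar> \<le> 1}"
    and "Y = {y. H (vexp y) \<le> 1}"
  shows "C_SAGE_POLY \<alpha> X = {c. SR \<alpha> c \<inter> C_SAGE (real_mat \<alpha>) Y \<noteq> {}}"
proof (intro set_eqI iffI)
  fix c
  assume c: "c \<in> C_SAGE_POLY \<alpha> X"
  show "c \<in> {c. SR \<alpha> c \<inter> C_SAGE (real_mat \<alpha>) Y \<noteq> {}}"
  proof (cases "Y = {}")
    case True
    then show ?thesis
      by (simp add: C_SAGE_empty SR_nonempty)
  next
    case Y: False
    have X: "x \<in> X" if "y \<in> Y" "\<bar>x\<bar> = vexp y" for x y
    proof -
      have "x \<in> {x. (\<forall>i. 0 < \<bar>x\<bar> $ i) \<and> H \<bar>x\<bar> \<le> 1}"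
        using that assms(3) by (auto simp: vexp_def)
      then show ?thesis
        unfolding assms(2) by (rule subsetD[OF closure_subset])
    qed
    from c obtain f where f: "c = (\<Sum>k\<in>UNIV. f k)" "\<And>k. f k \<in> C_AGE_POLY \<alpha> k X"
      by (auto simp: mem_C_SAGE_POLY_iff)
    define g where
      "g k = (\<chi> j. if \<alpha> $ j \<in> even_vecs then f k $ j else - \<bar>f k $ j\<bar>)" for k
    have g: "g k \<in> C_AGE (real_mat \<alpha>) k Y" for k
      unfolding g_def using C_AGE_POLY_imp_C_AGE[OF f(2) X Y] .
    from Y obtain y where y: "y \<in> Y"
      by blast
    have f0: "f k $ j = 0" if "\<alpha> $ j \<notin> even_vecs" "k \<noteq> j" for j k
      using C_AGE_POLY_offdiagonal(2)[OF f(2) X[OF y]] that by simp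
    have "(\<Sum>k\<in>UNIV. g k) $ j = c $ j" if "\<alpha> $ j \<in> even_vecs" for j
      using that f(1) by (simp add: g_def)
    \<comment> \<open>The modulus commutes with this sum because only the summand with
      \<open>k = j\<close> can be nonzero at an odd \<open>j\<close>.\<close>
    moreover have "(\<Sum>k\<in>UNIV. g k) $ j = - \<bar>c $ j\<bar>" if "\<alpha> $ j \<notin> even_vecs" for j
      using that f0 unfolding f(1)
      by (simp add: sum_component_eq_diagonal g_def del: sum_component)
    ultimately have "(\<Sum>k\<in>UNIV. g k) \<in> SR \<alpha> c"
      by (simp add: SR_def del: sum_component)
    with g show ?thesis
      unfolding mem_Collect_eq using mem_C_SAGE_iff[of _ "real_mat \<alpha>" Y] by blast
  qed
next
  fix c
  assume "c \<in> {c. SR \<alpha> c \<inter> C_SAGE (real_mat \<alpha>) Y \<noteq> {}}"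
  then obtain d where d: "d \<in> SR \<alpha> c" "d \<in> C_SAGE (real_mat \<alpha>) Y"
    by blast
  have nonpos: "d $ i \<le> 0" if "\<alpha> $ i \<notin> even_vecs" for i
    using d(1) that abs_ge_zero[of "c $ i"] unfolding SR_def by fastforce
  obtain f where f: "d = (\<Sum>k\<in>UNIV. f k)" "\<And>k. f k \<in> C_AGE (real_mat \<alpha>) k Y"
    and f0: "\<And>i k. \<alpha> $ i \<notin> even_vecs \<Longrightarrow> k \<noteq> i \<Longrightarrow> f k $ i = 0"
    using C_SAGE_decomposition_nonpos[OF d(2), of "{i. \<alpha> $ i \<notin> even_vecs}"] nonpos by auto
  \<comment> \<open>Restore the original coefficient at the odd diagonal entries. All other summands
    vanish there, so \<open>f k $ k\<close> is the whole of \<open>d $ k\<close>, hence at most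
    \<open>- \<bar>c $ k\<bar>\<close>.\<close>
  define g where
    "g k = (\<chi> j. if j = k \<and> \<alpha> $ j \<notin> even_vecs then c $ j else f k $ j)" for k
  have fd: "f k $ k = d $ k" if "\<alpha> $ k \<notin> even_vecs" for k
    using sum_component_eq_diagonal[of k f] f0[of k] that f(1) by simp
  have S: "\<exists>y\<in>Y. \<bar>x\<bar> = vexp y" if "x \<in> {x. (\<forall>i. 0 < \<bar>x\<bar> $ i) \<and> H \<bar>x\<bar> \<le> 1}" for x
    using that vexp_ln[of "\<bar>x\<bar>"] assms(3)
    by (intro bexI[of _ "\<chi> i. ln (\<bar>x\<bar> $ i)"]) auto
  have "g k \<in> C_AGE_POLY \<alpha> k X" for k
    unfolding assms(2)
  proof (rule C_AGE_imp_C_AGE_POLY[OF f(2) _ _ _ S])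
    show "if \<alpha> $ k \<in> even_vecs then g k $ k = f k $ k else f k $ k \<le> - \<bar>g k $ k\<bar>"
      using d(1) fd[of k] by (simp add: g_def SR_def)
  qed (use f0 in \<open>auto simp: g_def\<close>)
  moreover have "c = (\<Sum>k\<in>UNIV. g k)"
  proof -
    have "c $ j = (\<Sum>k\<in>UNIV. g k) $ j" for j
    proof (cases "\<alpha> $ j \<in> even_vecs")
      case True
      then show ?thesis
        using d(1) f(1) by (simp add: SR_def g_def)
    next
      case False
      then show ?thesis
        using f0[of j] sum_component_eq_diagonal[of j g] by (simp add: g_def)
    qed
    then show ?thesis
      by (simp add: vec_eq_iff)
  qed
  ultimately show "c \<in> C_SAGE_POLY \<alpha> X"
    by (auto simp: mem_C_SAGE_POLY_iff)
qed

end
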